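(* Let $1\le k\le n$. Let $\mathrm{OGr}(k,n)\subset \mathrm{Gr}(k,n)\subset \mathbb{P}(\wedge^k\mathbb{C}^n)$ be the variety of $k$-dimensional subspaces $V\subseteq\mathbb{C}^n$ that are isotropic for the standard symmetric bilinear form $(x,y)=x_1y_1+\dots+x_ny_n$ (i.e. $(x,y)=0$ for all $x,y\in V$). Then, in addition to the Plücker relations, $\mathrm{OGr}(k,n)$ is cut out set-theoretically in $\mathbb{P}(\wedge^k\mathbb{C}^n)$ by the following $\frac12\binom{n}{k-1}\left(\binom{n}{k-1}+1\right)$ quadratic equations, one for each unordered pair $\{I,J\}$ (with $I=J$ allowed) of $(k-1)$-element subsets of $[n]$, each written as an increasing string: $$\sum_{\ell=1}^{n}\varepsilon(I\ell)\,\varepsilon(J\ell)\,p_{I\ell}\,p_{J\ell}=0 .$$ That is, a point of $\mathbb{P}(\wedge^k\mathbb{C}^n)$ lies in $\mathrm{OGr}(k,n)$ if and only if it satisfies the Plücker relations and all of these equations.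
   Context: Plücker coordinates on $\mathbb{P}(\wedge^k\mathbb{C}^n)$ are denoted $p_I$ for $k$-subsets $I\subseteq[n]$. For a $(k-1)$-subset $I=\{i_1<\dots<i_{k-1}\}$ and $\ell\in[n]$, $I\ell$ denotes the string $i_1\cdots i_{k-1}\ell$; $p_{I\ell}$ denotes the Plücker coordinate indexed by the underlying set $I\cup\{\ell\}$ (and is $0$ if $\ell\in I$), and $\varepsilon(I\ell)$ is the sign of the permutation that sorts the string $I\ell$ into increasing order. *)

theory Defs
  imports "HOL-Analysis.Analysis" "HOL-Combinatorics.Permutations"
    "Jordan_Normal_Form.Determinant"
begin

text \<open>
  The index set \<open>[n]\<close> is the universe of a finite linearly ordered type \<open>'n\<close>, so
  \<open>n = CARD('n)\<close> and \<open>\<complex>\<^sup>n\<close> is the type \<open>complex ^ 'n\<close>; linear algebra over \<open>\<complex>\<close>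
  is that of \<open>vec.subspace\<close>, \<open>vec.span\<close> and \<open>vec.dim\<close> (the unqualified constants are the
  real ones).  An element of the exterior power \<open>\<And>\<^sup>k \<complex>\<^sup>n\<close> is given by its coordinates in the
  standard basis: a function on subsets of \<open>[n]\<close> that vanishes off the \<open>k\<close>-subsets.
\<close>

definition ext_power :: "nat \<Rightarrow> ('n::{finite,linorder} set \<Rightarrow> complex) set" where
  "ext_power k = {p. \<forall>I. card I \<noteq> k \<longrightarrow> p I = 0}"

text \<open>A projective point is the set of all its (nonzero) homogeneous coordinate vectors.\<close>

definition proj_point :: "('i \<Rightarrow> complex) \<Rightarrow> ('i \<Rightarrow> complex) set" where
  "proj_point p = {(\<lambda>i. c * p i) | c. c \<noteq> 0}"

definition proj_ext_power :: "nat \<Rightarrow> ('n::{finite,linorder} set \<Rightarrow> complex) set set" where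
  "proj_ext_power k = {proj_point p | p. p \<in> ext_power k \<and> p \<noteq> (\<lambda>_. 0)}"

definition ordered_basis :: "nat \<Rightarrow> (nat \<Rightarrow> complex ^ 'n) \<Rightarrow> (complex ^ 'n::finite) set \<Rightarrow> bool" where
  "ordered_basis k v V \<longleftrightarrow>
     inj_on v {..<k} \<and> vec.independent (v ` {..<k}) \<and> vec.span (v ` {..<k}) = V"

text \<open>
  The coordinates of \<open>v 0 \<and> \<dots> \<and> v (k - 1)\<close>: the maximal minors of the \<open>k \<times> n\<close> matrix with
  rows \<open>v 0, \<dots>, v (k - 1)\<close>.
\<close>

definition plucker_vector ::
  "nat \<Rightarrow> (nat \<Rightarrow> complex ^ 'n::{finite,linorder}) \<Rightarrow> 'n set \<Rightarrow> complex" where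
  "plucker_vector k v I =
     (if card I = k
      then Determinant.det (Matrix.mat k k (\<lambda>(r, c). vec_nth (v r) (sorted_list_of_set I ! c)))
      else 0)"

definition subspaces_of_dim :: "nat \<Rightarrow> (complex ^ 'n::finite) set set" where
  "subspaces_of_dim k = {V. vec.subspace V \<and> vec.dim V = k}"

definition Gr :: "nat \<Rightarrow> ('n::{finite,linorder} set \<Rightarrow> complex) set set" where
  "Gr k = {proj_point (plucker_vector k v) | V v. V \<in> subspaces_of_dim k \<and> ordered_basis k v V}"

text \<open>The form is complex bilinear, not Hermitian, hence not the library's inner product.\<close>

definition std_form :: "complex ^ 'n \<Rightarrow> complex ^ 'n::finite \<Rightarrow> complex" where
  "std_form x y = (\<Sum>i\<in>UNIV. vec_nth x i * vec_nth y i)"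

definition isotropic :: "(complex ^ 'n::finite) set \<Rightarrow> bool" where
  "isotropic V \<longleftrightarrow> (\<forall>x\<in>V. \<forall>y\<in>V. std_form x y = 0)"

definition OGr :: "nat \<Rightarrow> ('n::{finite,linorder} set \<Rightarrow> complex) set set" where
  "OGr k = {proj_point (plucker_vector k v) | V v.
     V \<in> subspaces_of_dim k \<and> isotropic V \<and> ordered_basis k v V}"

text \<open>
  The sorting permutation is unique only for strings without repetition; on other strings, where
  the sign is always multiplied by a vanishing coordinate, it is \<open>0\<close> by convention.
\<close>

definition string_sign :: "'a::linorder list \<Rightarrow> int" where
  "string_sign xs =
     (if distinct xs
      then sign (THE \<pi>. \<pi> permutes {..<length xs} \<and> permute_list \<pi> xs = sort xs)
      else 0)"

definition eps :: "'n::{finite,linorder} set \<Rightarrow> 'n \<Rightarrow> complex" where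
  "eps I l = of_int (string_sign (sorted_list_of_set I @ [l]))"

definition coord :: "('n set \<Rightarrow> complex) \<Rightarrow> 'n::{finite,linorder} set \<Rightarrow> 'n \<Rightarrow> complex" where
  "coord p I l = (if l \<in> I then 0 else p (insert l I))"

text \<open>
  The Pluecker relations
  \<open>\<Sum>\<^sub>a (-1)\<^sup>a p(i\<^sub>1 \<dots> i\<^bsub>k-1\<^esub> j\<^sub>a) p(j\<^sub>1 \<dots> j\<^bsub>a-1\<^esub> j\<^bsub>a+1\<^esub> \<dots> j\<^bsub>k+1\<^esub>) = 0\<close>, where \<open>p\<close> of a string
  is alternating; the exponent below is the position of \<open>j = j\<^sub>a\<close> in \<open>J\<close>, counted from \<open>0\<close>.
\<close>

definition plucker_relations :: "nat \<Rightarrow> ('n::{finite,linorder} set \<Rightarrow> complex) \<Rightarrow> bool" where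
  "plucker_relations k p \<longleftrightarrow>
     (\<forall>I J. card I = k - 1 \<and> card J = k + 1 \<longrightarrow>
        (\<Sum>j\<in>J. (-1) ^ card {m \<in> J. m < j} * eps I j * coord p I j * p (J - {j})) = 0)"

text \<open>Unordered pairs with repetition: a pair with equal entries is the singleton \<open>{I}\<close>.\<close>

definition unordered_pairs :: "nat \<Rightarrow> 'n::{finite,linorder} set set set" where
  "unordered_pairs k = {{I, J} | I J. card I = k - 1 \<and> card J = k - 1}"

end

theory Submission
  imports Defs
begin

text \<open>
  To \<open>p\<close> and a \<open>(k - 1)\<close>-subset \<open>I\<close> attach the vector \<open>w\<^sub>I\<close> with entries \<open>\<epsilon>(Il) p\<^sub>I\<^sub>l\<close>, so that the
  quadratic equations say that the \<open>w\<^sub>I\<close> span an isotropic space.  If \<open>p\<close> is the Pluecker vector of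
  \<open>V\<close>, then Laplace expansion along the column \<open>l\<close> shows \<open>w\<^sub>I \<in> V\<close>.  Conversely, if \<open>p\<close> satisfies
  the Pluecker relations and \<open>p\<^sub>K \<noteq> 0\<close>, the vectors \<open>w\<^bsub>K - {a}\<^esub>\<close> for \<open>a \<in> K\<close> are, up to scaling, dual
  to the coordinates in \<open>K\<close>; they span a \<open>k\<close>-dimensional space whose Pluecker vector is proportional
  to \<open>p\<close>, because the relations determine \<open>p\<close> from \<open>p\<^sub>K\<close> and these vectors.
\<close>

section \<open>Signs and minors indexed by strings\<close>

definition string_minor :: "nat \<Rightarrow> (nat \<Rightarrow> complex ^ 'n) \<Rightarrow> 'n list \<Rightarrow> complex" where
  "string_minor k v xs = Determinant.det (Matrix.mat k k (\<lambda>(r, c). vec_nth (v r) (xs ! c)))"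

text \<open>The interior product: contracting the \<open>k\<close>-vector \<open>p\<close> with the
  dual basis element indexed by \<open>I\<close> leaves this vector.\<close>

definition contraction :: "('n set \<Rightarrow> complex) \<Rightarrow> 'n set \<Rightarrow> complex ^ 'n::{finite,linorder}" where
  "contraction p I = (\<chi> l. eps I l * coord p I l)"

text \<open>Evaluates the definite description in \<open>string_sign\<close>: when no entry repeats,
  every position of the sorted string determines the position it came from, so the sorting
  permutation is unique.\<close>

lemma string_sign_distinct:
  assumes "distinct xs"
  obtains \<pi> where "\<pi> permutes {..<length xs}" "permute_list \<pi> xs = sort xs"
    "string_sign xs = sign \<pi>"
proof -
  obtain \<pi> where \<pi>: "\<pi> permutes {..<length xs}" "permute_list \<pi> xs = sort xs"
    using mset_eq_permutation[of "sort xs" xs] by auto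
  have "\<sigma> = \<pi>" if \<sigma>: "\<sigma> permutes {..<length xs}" "permute_list \<sigma> xs = sort xs" for \<sigma>
  proof
    fix i
    show "\<sigma> i = \<pi> i"
    proof (cases "i < length xs")
      case True
      then have "xs ! \<sigma> i = xs ! \<pi> i"
        using \<pi> \<sigma> by (metis permute_list_nth)
      moreover have "\<sigma> i < length xs" "\<pi> i < length xs"
        using True permutes_in_image[OF \<sigma>(1), of i] permutes_in_image[OF \<pi>(1), of i] by auto
      ultimately show ?thesis
        using assms by (simp add: nth_eq_iff_index_eq)
    next
      case False
      then show ?thesis
        using \<pi>(1) \<sigma>(1) by (simp add: permutes_not_in)
    qed
  qed
  then have "(THE \<pi>. \<pi> permutes {..<length xs} \<and> permute_list \<pi> xs = sort xs) = \<pi>"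
    using \<pi> by (blast intro: the_equality)
  then show thesis
    using that \<pi> assms by (simp add: string_sign_def)
qed

lemma string_minor_permute:
  assumes "\<pi> permutes {..<k}" and "length xs = k"
  shows "string_minor k v (permute_list \<pi> xs) = of_int (sign \<pi>) * string_minor k v xs"
proof -
  let ?A = "Matrix.mat k k (\<lambda>(r, c). vec_nth (v r) (xs ! c))"
  let ?B = "Matrix.mat k k (\<lambda>(i, j). transpose_mat ?A $$ (\<pi> i, j))"
  have lt: "\<pi> i < k" if "i < k" for i
    using that permutes_in_image[OF assms(1), of i] by auto
  \<comment> \<open>Reordering the string reorders columns, which are the rows of the
    transpose.\<close>
  have "Matrix.mat k k (\<lambda>(r, c). vec_nth (v r) (permute_list \<pi> xs ! c)) = transpose_mat ?B"
    using assms lt by (intro eq_matI) (auto simp: permute_list_nth)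
  then have "string_minor k v (permute_list \<pi> xs) = Determinant.det ?B"
    unfolding string_minor_def by (simp add: Determinant.det_transpose[of _ k])
  also have "\<dots> = of_int (sign \<pi>) * Determinant.det (transpose_mat ?A)"
    using Determinant.det_permute_rows[of "transpose_mat ?A" k \<pi>] assms(1)
    by (simp add: lessThan_atLeast0 sign_def)
  also have "\<dots> = of_int (sign \<pi>) * string_minor k v xs"
    by (simp add: string_minor_def Determinant.det_transpose[of _ k])
  finally show ?thesis .
qed

text \<open>Sorting the columns of a minor costs exactly the sign of the string. A repeated entry
  gives two equal columns, so the minor vanishes in accordance with the value \<open>0\<close> of
  \<open>string_sign\<close>.\<close>

lemma plucker_vector_string:
  assumes "length xs = k"
  shows "of_int (string_sign xs) * plucker_vector k v (set xs) = string_minor k v xs"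
proof (cases "distinct xs")
  case True
  then obtain \<pi> where \<pi>: "\<pi> permutes {..<length xs}" "permute_list \<pi> xs = sort xs"
    "string_sign xs = sign \<pi>"
    by (rule string_sign_distinct)
  have "sorted_list_of_set (set xs) = permute_list \<pi> xs"
    using True \<pi>(2) by (simp add: sorted_list_of_set_sort_remdups distinct_remdups_id)
  then have "plucker_vector k v (set xs) = string_minor k v (permute_list \<pi> xs)"
    using True assms by (simp add: plucker_vector_def string_minor_def distinct_card)
  also have "\<dots> = of_int (sign \<pi>) * string_minor k v xs"
    using string_minor_permute \<pi>(1) assms by blast
  \<comment> \<open>The sign now occurs squared, hence cancels.\<close>
  finally show ?thesis
    using \<pi>(3) by (simp add: sign_def)
next
  case False
  then obtain i j where ij: "i < k" "j < k" "i \<noteq> j" "xs ! i = xs ! j"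
    using assms by (auto simp: distinct_conv_nth)
  then have "string_minor k v xs = 0"
    unfolding string_minor_def
    by (intro Determinant.det_identical_columns[of _ k i j]) (auto intro!: eq_vecI)
  then show ?thesis
    using False by (simp add: string_sign_def)
qed

lemma contraction_plucker_vector:
  assumes "card I = k"
  shows "vec_nth (contraction (plucker_vector (Suc k) v) I) l
    = string_minor (Suc k) v (sorted_list_of_set I @ [l])"
proof -
  have "of_int (string_sign (sorted_list_of_set I @ [l])) * plucker_vector (Suc k) v (insert l I)
    = string_minor (Suc k) v (sorted_list_of_set I @ [l])"
    using plucker_vector_string[of "sorted_list_of_set I @ [l]" "Suc k" v] assms
    by simp
  moreover have "l \<in> I \<Longrightarrow> string_sign (sorted_list_of_set I @ [l]) = 0"
    by (simp add: string_sign_def)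
  ultimately show ?thesis
    by (auto simp: contraction_def eps_def coord_def)
qed

lemma eps_nonzero:
  assumes "l \<notin> I"
  shows "eps I l \<noteq> 0"
  using assms by (simp add: eps_def string_sign_def sign_def)

section \<open>Contractions of a Pluecker vector as combinations of the rows\<close>

text \<open>Laplace expansion along the last column. The cofactors delete that column and so do not
  depend on \<open>l\<close>; the cofactor of the last row has sign
  \<open>(-1) ^ (k + k) = 1\<close>.\<close>

lemma string_minor_expand_last:
  assumes "length xs = k"
  obtains c where "\<And>l. string_minor (Suc k) v (xs @ [l]) = (\<Sum>r<Suc k. c r * vec_nth (v r) l)"
    and "c k = string_minor k v xs"
proof -
  define c where "c r = (-1) ^ (r + k) * Determinant.det (Matrix.mat k k (\<lambda>(i, j).
    vec_nth (v (if i < r then i else Suc i)) (xs ! j)))" for r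
  have "string_minor (Suc k) v (xs @ [l]) = (\<Sum>r<Suc k. c r * vec_nth (v r) l)" for l
  proof -
    let ?A = "Matrix.mat (Suc k) (Suc k) (\<lambda>(r, c). vec_nth (v r) ((xs @ [l]) ! c))"
    have "mat_delete ?A r k = Matrix.mat k k (\<lambda>(i, j).
        vec_nth (v (if i < r then i else Suc i)) (xs ! j))" if "r < Suc k" for r
      using that assms by (intro eq_matI) (auto simp: mat_delete_def nth_append)
    then have "cofactor ?A r k = c r" if "r < Suc k" for r
      using that by (simp add: cofactor_def c_def)
    then show ?thesis
      unfolding string_minor_def
      by (subst laplace_expansion_column[of _ "Suc k" k])
         (auto simp: nth_append assms mult.commute intro!: sum.cong)
  qed
  moreover have "c k = string_minor k v xs"
    unfolding c_def string_minor_def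
    by (auto intro!: arg_cong[where f = Determinant.det] eq_matI simp flip: mult_2)
  ultimately show thesis
    by (rule that)
qed

text \<open>The first conclusion puts contractions into the row space. The value of the last
  coefficient serves the induction that finds a nonzero minor of independent rows.\<close>

lemma contraction_plucker_vector_expand:
  assumes "card I = k"
  obtains c where "contraction (plucker_vector (Suc k) v) I = (\<Sum>r<Suc k. c r *s v r)"
    and "c k = plucker_vector k v I"
proof -
  obtain c where c: "\<And>l. string_minor (Suc k) v (sorted_list_of_set I @ [l])
      = (\<Sum>r<Suc k. c r * vec_nth (v r) l)" "c k = string_minor k v (sorted_list_of_set I)"
    using string_minor_expand_last[of "sorted_list_of_set I" k v] assms by auto
  have "contraction (plucker_vector (Suc k) v) I = (\<Sum>r<Suc k. c r *s v r)"
    unfolding Finite_Cartesian_Product.vec_eq_iff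
    by (simp add: contraction_plucker_vector[OF assms] c(1))
  moreover have "c k = plucker_vector k v I"
    using c(2) assms by (simp add: plucker_vector_def string_minor_def)
  ultimately show thesis
    by (rule that)
qed

section \<open>The Pluecker relations hold for minors\<close>

text \<open>Translates the sign and the set \<open>J - {j}\<close> in a Pluecker relation into the
  position and the deleted column of a Laplace expansion.\<close>

lemma sorted_list_of_set_split:
  assumes "finite J" and "sorted_list_of_set J = ys @ y # zs"
  shows "sorted_list_of_set (J - {y}) = ys @ zs" and "card {m \<in> J. m < y} = length ys"
proof -
  have J: "J = set (ys @ y # zs)"
    using assms by (metis sorted_list_of_set.set_sorted_key_list_of_set)
  have s: "sorted_wrt (<) (ys @ y # zs)"
    using assms(2) by (metis sorted_list_of_set.strict_sorted_key_list_of_set)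
  then have "sorted_wrt (<) (ys @ zs)"
    by (auto simp: sorted_wrt_append)
  moreover have "set (ys @ zs) = J - {y}"
    using s J by (auto simp: sorted_wrt_append)
  ultimately show "sorted_list_of_set (J - {y}) = ys @ zs"
    by (metis List.finite_set sorted_list_of_set.finite_set_strict_sorted strict_sorted_equal sorted_list_of_set.idem_if_sorted_distinct strict_sorted_iff)
  have "{m \<in> J. m < y} = set ys"
    using s J by (auto simp: sorted_wrt_append)
  moreover have "distinct ys"
    using s by (simp add: sorted_wrt_append strict_sorted_iff)
  ultimately show "card {m \<in> J. m < y} = length ys"
    by (simp add: distinct_card)
qed

text \<open>The sum is the expansion along the first row of the determinant, in the columns
  \<open>J\<close>, of the rows \<open>v 0, ..., v (k - 1)\<close> with a second copy of
  \<open>v s\<close> placed on top.\<close>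

lemma sum_plucker_vector_eq_0:
  fixes v :: "nat \<Rightarrow> complex ^ 'n::{finite,linorder}"
  assumes "card J = Suc k" and "s < k"
  shows "(\<Sum>j\<in>J. (-1) ^ card {m \<in> J. m < j} * vec_nth (v s) j * plucker_vector k v (J - {j})) = 0"
proof -
  define xs where "xs = sorted_list_of_set J"
  have xs: "distinct xs" "set xs = J" "length xs = Suc k"
    using assms by (auto simp: xs_def)
  let ?w = "\<lambda>r. case r of 0 \<Rightarrow> v s | Suc r \<Rightarrow> v r"
  let ?A = "Matrix.mat (Suc k) (Suc k) (\<lambda>(r, c). vec_nth (?w r) (xs ! c))"
  have "(\<Sum>j\<in>J. (-1) ^ card {m \<in> J. m < j} * vec_nth (v s) j * plucker_vector k v (J - {j}))
      = (\<Sum>c<Suc k. (-1) ^ card {m \<in> J. m < xs ! c} * vec_nth (v s) (xs ! c)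
          * plucker_vector k v (J - {xs ! c}))"
    by (rule sum.reindex_bij_betw[symmetric]) (use xs in \<open>auto intro: bij_betw_nth\<close>)
  also have "\<dots> = (\<Sum>c<Suc k. ?A $$ (0, c) * cofactor ?A 0 c)"
  proof (rule sum.cong[OF refl])
    fix c assume "c \<in> {..<Suc k}"
    then have c: "c < Suc k" by simp
    have split: "sorted_list_of_set J = take c xs @ xs ! c # drop (Suc c) xs"
      using c xs by (simp add: xs_def id_take_nth_drop[symmetric])
    have "card (J - {xs ! c}) = k"
      using c xs assms(1) by (metis card_Diff_singleton diff_Suc_1 nth_mem)
    moreover have "(take c xs @ drop (Suc c) xs) ! j = xs ! (if j < c then j else Suc j)"
      if "j < k" for j
      using that c xs by (auto simp: nth_append)
    moreover from this have "Matrix.mat k k (\<lambda>(r, j). vec_nth (v r) ((take c xs @ drop (Suc c) xs) ! j))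
        = mat_delete ?A 0 c"
      using c by (intro eq_matI) (auto simp: mat_delete_def)
    ultimately have "plucker_vector k v (J - {xs ! c}) = Determinant.det (mat_delete ?A 0 c)"
      using sorted_list_of_set_split(1)[OF finite split] by (simp add: plucker_vector_def)
    then show "(-1) ^ card {m \<in> J. m < xs ! c} * vec_nth (v s) (xs ! c)
          * plucker_vector k v (J - {xs ! c}) = ?A $$ (0, c) * cofactor ?A 0 c"
      using c xs sorted_list_of_set_split(2)[OF finite split] by (simp add: cofactor_def)
  qed
  also have "\<dots> = Determinant.det ?A"
    by (rule laplace_expansion_row[symmetric]) auto
  also have "\<dots> = 0"
    by (rule Determinant.det_identical_rows[of _ "Suc k" 0 "Suc s"])
       (use assms in \<open>auto intro!: eq_vecI\<close>)
  finally show ?thesis .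
qed

lemma plucker_relations_iff:
  "plucker_relations k p \<longleftrightarrow> (\<forall>I J. card I = k - 1 \<and> card J = k + 1 \<longrightarrow>
     (\<Sum>j\<in>J. (-1) ^ card {m \<in> J. m < j} * vec_nth (contraction p I) j * p (J - {j})) = 0)"
  by (simp add: plucker_relations_def contraction_def mult.assoc)

text \<open>For fixed \<open>J\<close> the relation is linear in the contraction, which is a
  combination of the rows; for each single row the sum is a determinant with a repeated row.\<close>

lemma plucker_relations_plucker_vector:
  assumes "1 \<le> k"
  shows "plucker_relations k (plucker_vector k v)"
  unfolding plucker_relations_iff
proof (intro allI impI)
  fix I J :: "'a set"
  assume IJ: "card I = k - 1 \<and> card J = k + 1"
  \<comment> \<open>By \<open>1 \<le> k\<close>, the number of rows \<open>Suc (k - 1)\<close> in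
    the expansion is \<open>k\<close>.\<close>
  obtain c where c: "contraction (plucker_vector k v) I = (\<Sum>r<k. c r *s v r)"
    using contraction_plucker_vector_expand[of I "k - 1" v] IJ assms by auto
  have "(\<Sum>j\<in>J. (-1) ^ card {m \<in> J. m < j} * vec_nth (contraction (plucker_vector k v) I) j
        * plucker_vector k v (J - {j}))
      = (\<Sum>r<k. c r * (\<Sum>j\<in>J. (-1) ^ card {m \<in> J. m < j} * vec_nth (v r) j
          * plucker_vector k v (J - {j})))"
    unfolding c sum_distrib_left
    by (subst sum.swap) (simp add: sum_distrib_left sum_distrib_right mult_ac)
  also have "\<dots> = 0"
    using IJ by (simp add: sum_plucker_vector_eq_0)
  finally show "(\<Sum>j\<in>J. (-1) ^ card {m \<in> J. m < j}
      * vec_nth (contraction (plucker_vector k v) I) j * plucker_vector k v (J - {j})) = 0" .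
qed

lemma contraction_scale: "contraction (\<lambda>M. c * p M) I = c *s contraction p I"
  by (simp add: Finite_Cartesian_Product.vec_eq_iff contraction_def coord_def)

lemma plucker_relations_scale:
  assumes "plucker_relations k p"
  shows "plucker_relations k (\<lambda>M. c * p M)"
  unfolding plucker_relations_iff
proof (intro allI impI)
  fix I J :: "'a set"
  assume IJ: "card I = k - 1 \<and> card J = k + 1"
  have "(\<Sum>j\<in>J. (-1) ^ card {m \<in> J. m < j} * vec_nth (contraction (\<lambda>M. c * p M) I) j
        * (c * p (J - {j})))
      = c ^ 2 * (\<Sum>j\<in>J. (-1) ^ card {m \<in> J. m < j} * vec_nth (contraction p I) j * p (J - {j}))"
    by (simp add: contraction_scale sum_distrib_left power2_eq_square mult_ac)
  also have "\<dots> = 0"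
    using assms IJ unfolding plucker_relations_iff by simp
  finally show "(\<Sum>j\<in>J. (-1) ^ card {m \<in> J. m < j} * vec_nth (contraction (\<lambda>M. c * p M) I) j
        * (c * p (J - {j}))) = 0" .
qed

section \<open>Solutions of the Pluecker relations are Pluecker vectors\<close>

text \<open>For \<open>b\<close> other than \<open>a\<close>, \<open>b\<close> lies in
  \<open>K - {a}\<close>, where \<open>coord\<close> vanishes; for \<open>b = a\<close>, inserting
  \<open>a\<close> restores \<open>K\<close>.\<close>

lemma contraction_remove:
  assumes "a \<in> K" and "b \<in> K"
  shows "vec_nth (contraction p (K - {a})) b = (if a = b then eps (K - {a}) a * p K else 0)"
  using assms by (auto simp: contraction_def coord_def insert_absorb)

text \<open>
  For \<open>a \<in> K - M\<close> the relation of \<open>K - {a}\<close> and \<open>M \<union> {a}\<close> expresses \<open>p K * p M\<close> through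
  coordinates at sets closer to \<open>K\<close>.
\<close>

lemma plucker_relations_unique:
  fixes p q :: "'n::{finite,linorder} set \<Rightarrow> complex"
  assumes "plucker_relations k p" and "plucker_relations k q"
    and "card K = k" and "p K \<noteq> 0" and "q K = p K"
    and eq: "\<And>a. a \<in> K \<Longrightarrow> contraction p (K - {a}) = contraction q (K - {a})"
    and "card M = k"
  shows "p M = q M"
  using \<open>card M = k\<close>
proof (induction "card (M - K)" arbitrary: M rule: less_induct)
  case less
  show ?case
  proof (cases "M = K")
    case True
    then show ?thesis
      using assms(5) by simp
  next
    case False
    then have "\<not> K \<subseteq> M"
      using less.prems assms(3) card_subset_eq[of M K] by auto
    then obtain a where a: "a \<in> K" "a \<notin> M"
      by blast
    \<comment> \<open>These coefficients involve only the contraction at \<open>K - {a}\<close>, so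
      \<open>p\<close> and \<open>q\<close> satisfy the same linear equation.\<close>
    let ?s = "\<lambda>j. (-1) ^ card {m \<in> insert a M. m < j} * vec_nth (contraction p (K - {a})) j"
    have rel: "?s a * f M + (\<Sum>j\<in>M. ?s j * f (insert a M - {j})) = 0"
      if "plucker_relations k f" "contraction f (K - {a}) = contraction p (K - {a})" for f
    proof -
      have "card (K - {a}) = k - 1" "card (insert a M) = k + 1"
        using a assms(3) less.prems by auto
      then have "(\<Sum>j\<in>insert a M. ?s j * f (insert a M - {j})) = 0"
        using that(1) unfolding plucker_relations_iff that(2)[symmetric] by blast
      then show ?thesis
        using a by simp
    qed
    \<comment> \<open>If \<open>j\<close> is in \<open>K\<close>, then it differs from
      \<open>a\<close> and its coefficient is zero. Otherwise trading \<open>j\<close> for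
      \<open>a\<close> leaves fewer elements outside \<open>K\<close>, and the induction hypothesis
      applies.\<close>
    have "?s j * p (insert a M - {j}) = ?s j * q (insert a M - {j})" if "j \<in> M" for j
    proof (cases "j \<in> K")
      case True
      then show ?thesis
        using a that by (auto simp: contraction_remove)
    next
      case False
      have "insert a M - {j} - K \<subset> M - K"
        using a False that by blast
      then have "card (insert a M - {j} - K) < card (M - K)"
        by (intro psubset_card_mono) auto
      moreover have "card (insert a M - {j}) = k"
        using a that less.prems by simp
      ultimately show ?thesis
        using less.hyps by simp
    qed
    then have "?s a * p M = - (\<Sum>j\<in>M. ?s j * q (insert a M - {j}))"
      using rel[OF assms(1) refl] by (simp only: eq_neg_iff_add_eq_0 cong: sum.cong)
    also have "\<dots> = ?s a * q M"
      using rel[OF assms(2) eq[OF a(1), symmetric]] by (simp only: neg_eq_iff_add_eq_0 add.commute)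
    finally have "?s a * p M = ?s a * q M" .
    moreover have "?s a \<noteq> 0"
      using a assms(4) by (simp add: contraction_remove eps_nonzero)
    ultimately show ?thesis
      by simp
  qed
qed

text \<open>The contractions at \<open>K - {a}\<close> are rescaled so that their matrix in the
  columns \<open>K\<close> is the identity. The multiple \<open>q\<close> of the resulting Pluecker
  vector then agrees with \<open>p\<close> at \<open>K\<close> and in these contractions, so
  uniqueness gives \<open>p = q\<close>.\<close>

lemma plucker_relations_imp_plucker_vector:
  fixes p :: "'n::{finite,linorder} set \<Rightarrow> complex"
  assumes "p \<in> ext_power k" and "plucker_relations k p" and "1 \<le> k"
    and "card K = k" and "p K \<noteq> 0"
  obtains v c where
    "\<And>r s. r < k \<Longrightarrow> s < k \<Longrightarrow> vec_nth (v r) (sorted_list_of_set K ! s) = (if r = s then 1 else 0)"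
    "\<And>r. v r = c r *s contraction p (K - {sorted_list_of_set K ! r})"
    "p = (\<lambda>M. p K * plucker_vector k v M)"
proof -
  define xs where "xs = sorted_list_of_set K"
  have xs: "distinct xs" "set xs = K" "length xs = k"
    using assms(4) by (auto simp: xs_def)
  have inK: "xs ! r \<in> K" if "r < k" for r
    using that xs by auto
  \<comment> \<open>The entry of the contraction at \<open>K - {xs ! r}\<close> in its own
    coordinate \<open>xs ! r\<close>, the only nonzero one among those in \<open>K\<close>.\<close>
  define e where "e r = eps (K - {xs ! r}) (xs ! r) * p K" for r
  have e: "e r \<noteq> 0" for r
    using assms(5) by (simp add: e_def eps_nonzero)
  define v where "v r = (1 / e r) *s contraction p (K - {xs ! r})" for r
  have v: "vec_nth (v r) (xs ! s) = (if r = s then 1 else 0)" if "r < k" "s < k" for r s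
    using that xs e[of r] inK by (auto simp: v_def contraction_remove e_def nth_eq_iff_index_eq)
  define q where "q = (\<lambda>M. p K * plucker_vector k v M)"
  have "Matrix.mat k k (\<lambda>(r, c). vec_nth (v r) (xs ! c)) = 1\<^sub>m k"
    using v by (intro eq_matI) auto
  then have "plucker_vector k v K = 1"
    using assms(4) by (simp add: plucker_vector_def xs_def)
  then have qK: "q K = p K"
    by (simp add: q_def)
  have q: "plucker_relations k q"
    unfolding q_def by (intro plucker_relations_scale plucker_relations_plucker_vector assms(3))
  have "contraction p (K - {a}) = contraction q (K - {a})" if "a \<in> K" for a
  proof -
    obtain t where t: "t < k" "a = xs ! t"
      using \<open>a \<in> K\<close> xs by (metis in_set_conv_nth)
    have "card (K - {a}) = k - 1"
      using \<open>a \<in> K\<close> assms(4) by simp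
    then obtain c where "contraction (plucker_vector k v) (K - {a}) = (\<Sum>r<k. c r *s v r)"
      using contraction_plucker_vector_expand[of "K - {a}" "k - 1" v] assms(3) by auto
    then have c: "contraction q (K - {a}) = (\<Sum>r<k. (p K * c r) *s v r)"
      by (simp add: q_def contraction_scale vec.scale_sum_right)
    \<comment> \<open>The coefficients are read off in the coordinates \<open>xs ! s\<close>, to
      which the \<open>v r\<close> are dual.\<close>
    have "p K * c s = (if s = t then e t else 0)" if "s < k" for s
    proof -
      have "p K * c s = (\<Sum>r<k. p K * c r * (if r = s then 1 else 0))"
        using that by (simp add: mult_delta_right)
      also have "\<dots> = vec_nth (contraction q (K - {a})) (xs ! s)"
        using that v by (simp add: c)
      also have "\<dots> = (if s = t then e t else 0)"
        using that t xs inK \<open>a \<in> K\<close> qK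
        by (auto simp: contraction_remove e_def nth_eq_iff_index_eq)
      finally show ?thesis .
    qed
    then have "contraction q (K - {a}) = (\<Sum>r<k. (if r = t then e t else 0) *s v r)"
      unfolding c by (intro sum.cong) auto
    also have "\<dots> = (\<Sum>r<k. if r = t then e t *s v t else 0)"
      by (rule sum.cong) auto
    also have "\<dots> = e t *s v t"
      using t by simp
    also have "\<dots> = contraction p (K - {a})"
      using e[of t] t by (simp add: v_def)
    finally show ?thesis ..
  qed
  then have "p M = q M" if "card M = k" for M
    using plucker_relations_unique[of k p q K M] assms q qK that by simp
  moreover have "p M = q M" if "card M \<noteq> k" for M
    using that assms(1) by (simp add: ext_power_def q_def plucker_vector_def)
  ultimately have "p = q"
    by blast
  then show thesis
    using that[of v "\<lambda>r. 1 / e r"] v by (simp add: v_def q_def xs_def)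
qed

section \<open>Linear independence and minors\<close>

text \<open>Ensures that a Pluecker vector defines a projective point. If all minors of
  \<open>Suc k\<close> rows vanished, so would the contraction at an \<open>I\<close> with nonzero
  \<open>k\<close>-minor; its expansion would be a linear relation among the rows in which
  \<open>v k\<close> has that minor as coefficient.\<close>

lemma independent_nonzero_minor:
  fixes v :: "nat \<Rightarrow> complex ^ 'n::{finite,linorder}"
  assumes "inj_on v {..<k}" and "vec.independent (v ` {..<k})"
  shows "\<exists>I. plucker_vector k v I \<noteq> 0"
  using assms
proof (induction k)
  case 0
  have "plucker_vector 0 v {} \<noteq> 0"
    by (simp add: plucker_vector_def)
  then show ?case
    by blast
next
  case (Suc k)
  have "vec.independent (v ` {..<k})"
    using Suc.prems(2) by (rule vec.independent_mono) auto
  then obtain I where I: "plucker_vector k v I \<noteq> 0"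
    using Suc.IH Suc.prems(1) by (auto simp: inj_on_def)
  then have "card I = k"
    by (auto simp: plucker_vector_def split: if_splits)
  then obtain c where c: "contraction (plucker_vector (Suc k) v) I = (\<Sum>r<Suc k. c r *s v r)"
    "c k = plucker_vector k v I"
    by (rule contraction_plucker_vector_expand)
  show ?case
  proof (rule ccontr)
    assume "\<nexists>I. plucker_vector (Suc k) v I \<noteq> 0"
    then have "contraction (plucker_vector (Suc k) v) I = 0"
      by (simp add: Finite_Cartesian_Product.vec_eq_iff contraction_def coord_def)
    \<comment> \<open>Independence concerns coefficients attached to vectors, so the index is
      recovered by inverting \<open>v\<close>.\<close>
    then have "(\<Sum>x\<in>v ` {..<Suc k}. c (the_inv_into {..<Suc k} v x) *s x) = 0"
      using Suc.prems(1) unfolding c(1)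
      by (subst sum.reindex) (auto simp: the_inv_into_f_f)
    then have "c (the_inv_into {..<Suc k} v (v k)) = 0"
      by (intro vec.independentD[OF Suc.prems(2) _ subset_refl,
            where u = "\<lambda>x. c (the_inv_into {..<Suc k} v x)"]) auto
    then show False
      using I c(2) Suc.prems(1) by (simp add: the_inv_into_f_f)
  qed
qed

text \<open>The coordinate \<open>x s\<close> of a linear combination of the \<open>v r\<close> is
  the coefficient of \<open>v s\<close>.\<close>

lemma dual_coordinates_independent:
  fixes v :: "nat \<Rightarrow> complex ^ 'n::finite"
  assumes "\<And>r s. r < k \<Longrightarrow> s < k \<Longrightarrow> vec_nth (v r) (x s) = (if r = s then 1 else 0)"
  shows "inj_on v {..<k}" and "vec.independent (v ` {..<k})"
proof -
  show inj: "inj_on v {..<k}"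
  proof (rule inj_onI)
    fix r s assume "r \<in> {..<k}" "s \<in> {..<k}" "v r = v s"
    then have "(if s = r then 1 else 0) = (1 :: complex)"
      using assms[of r r] assms[of s r] by simp
    then show "r = s"
      by (metis zero_neq_one)
  qed
  show "vec.independent (v ` {..<k})"
  proof (rule vec.independent_if_scalars_zero)
    fix f y assume sum: "(\<Sum>x\<in>v ` {..<k}. f x *s x) = 0" and "y \<in> v ` {..<k}"
    then obtain s where s: "s < k" "y = v s"
      by auto
    have "0 = vec_nth (\<Sum>r<k. f (v r) *s v r) (x s)"
      using sum by (simp add: sum.reindex[OF inj])
    also have "\<dots> = (\<Sum>r<k. f (v r) * (if r = s then 1 else 0))"
      using s assms by simp
    also have "\<dots> = f y"
      using s by (simp add: mult_delta_right)
    finally show "f y = 0" ..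
  qed auto
qed

section \<open>The bilinear form and isotropic spans\<close>

lemma std_form_left_zero [simp]: "std_form 0 y = 0"
  and std_form_right_zero [simp]: "std_form y 0 = 0"
  and std_form_left_add: "std_form (x + x') y = std_form x y + std_form x' y"
  and std_form_right_add: "std_form y (x + x') = std_form y x + std_form y x'"
  and std_form_left_scale: "std_form (c *s x) y = c * std_form x y"
  and std_form_right_scale: "std_form y (c *s x) = c * std_form y x"
  by (simp_all add: std_form_def sum.distrib sum_distrib_left algebra_simps)

lemma isotropic_span:
  assumes "\<And>x y. x \<in> S \<Longrightarrow> y \<in> S \<Longrightarrow> std_form x y = 0"
  shows "isotropic (vec.span S)"
proof -
  have 1: "std_form x y = 0" if "x \<in> S" "y \<in> vec.span S" for x y
    using that(2)
    by (induction rule: vec.span_induct_alt)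
       (use that assms in \<open>auto simp: std_form_right_add std_form_right_scale\<close>)
  have "std_form x y = 0" if "x \<in> vec.span S" "y \<in> vec.span S" for x y
    using that(1)
    by (induction rule: vec.span_induct_alt)
       (use that 1 in \<open>auto simp: std_form_left_add std_form_left_scale\<close>)
  then show ?thesis
    by (simp add: isotropic_def)
qed

lemma contraction_form:
  "(\<Sum>l\<in>UNIV. eps I l * eps J l * coord p I l * coord p J l)
    = std_form (contraction p I) (contraction p J)"
  by (simp add: std_form_def contraction_def mult_ac)

section \<open>Counting the quadratic equations\<close>

text \<open>These sets are the singletons and the two-element subsets of \<open>A\<close>, so both
  binomial coefficients add up.\<close>

lemma card_doubletons:
  assumes "finite A"
  shows "card {{x, y} | x y. x \<in> A \<and> y \<in> A} = card A * (card A + 1) div 2"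
proof -
  have "{{x, y} | x y. x \<in> A \<and> y \<in> A}
      = {B. B \<subseteq> A \<and> card B = 1} \<union> {B. B \<subseteq> A \<and> card B = 2}"
  proof (intro equalityI subsetI)
    fix B assume "B \<in> {{x, y} | x y. x \<in> A \<and> y \<in> A}"
    then obtain x y where "B = {x, y}" "x \<in> A" "y \<in> A"
      by blast
    then show "B \<in> {B. B \<subseteq> A \<and> card B = 1} \<union> {B. B \<subseteq> A \<and> card B = 2}"
      by (cases "x = y") auto
  next
    fix B assume B: "B \<in> {B. B \<subseteq> A \<and> card B = 1} \<union> {B. B \<subseteq> A \<and> card B = 2}"
    then have "\<exists>x y. B = {x, y}"
      by (auto simp: card_2_iff card_1_singleton_iff)
    then show "B \<in> {{x, y} | x y. x \<in> A \<and> y \<in> A}"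
      using B by auto
  qed
  moreover have "card ({B. B \<subseteq> A \<and> card B = 1} \<union> {B. B \<subseteq> A \<and> card B = 2})
      = (card A choose 1) + (card A choose 2)"
    using assms by (subst card_Un_disjoint) (auto simp: n_subsets)
  moreover have "(m choose 1) + (m choose 2) = m * (m + 1) div 2" for m
    by (cases m) (simp_all add: choose_two)
  ultimately show ?thesis
    by metis
qed

lemma card_unordered_pairs:
  "card (unordered_pairs k :: 'n::{finite,linorder} set set set)
    = (CARD('n) choose (k - 1)) * ((CARD('n) choose (k - 1)) + 1) div 2"
proof -
  have "card {I :: 'n set. card I = k - 1} = CARD('n) choose (k - 1)"
    using n_subsets[of "UNIV :: 'n set" "k - 1"] by simp
  moreover have "unordered_pairs k
      = {{I, J} | I J. I \<in> {I :: 'n set. card I = k - 1} \<and> J \<in> {I. card I = k - 1}}"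
    by (simp add: unordered_pairs_def)
  ultimately show ?thesis
    using card_doubletons[of "{I :: 'n set. card I = k - 1}"] by simp
qed

section \<open>Projective points and the two directions of the equivalence\<close>

lemma proj_point_scale:
  assumes "c \<noteq> 0"
  shows "proj_point (\<lambda>i. c * p i) = proj_point p"
proof -
  have "(\<lambda>i. d * (c * p i)) = (\<lambda>i. (d * c) * p i)" "(\<lambda>i. d * p i) = (\<lambda>i. (d / c) * (c * p i))" for d
    using assms by auto
  then show ?thesis
    unfolding proj_point_def using assms
    by (safe; metis divide_eq_0_iff mult_eq_0_iff)
qed

lemma OGr_subset_Gr: "OGr k \<subseteq> Gr k"
  unfolding OGr_def Gr_def by blast

lemma Gr_subset_proj_ext_power: "Gr k \<subseteq> proj_ext_power k"
proof
  fix P :: "('a set \<Rightarrow> complex) set" assume "P \<in> Gr k"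
  then obtain v V where v: "P = proj_point (plucker_vector k v)" "ordered_basis k v V"
    unfolding Gr_def by blast
  then obtain I where "plucker_vector k v I \<noteq> 0"
    using independent_nonzero_minor unfolding ordered_basis_def by blast
  then have "plucker_vector k v \<noteq> (\<lambda>_. 0)"
    by metis
  moreover have "plucker_vector k v \<in> ext_power k"
    by (simp add: ext_power_def plucker_vector_def)
  ultimately show "P \<in> proj_ext_power k"
    using v(1) unfolding proj_ext_power_def by blast
qed

text \<open>All contractions of \<open>p\<close> lie in the isotropic space \<open>V\<close>, being
  combinations of its basis.\<close>

lemma OGr_imp_equations:
  assumes "1 \<le> k" and "P \<in> OGr k" and "p \<in> P"
  shows "plucker_relations k p"
    and "card I = k - 1 \<Longrightarrow> card J = k - 1 \<Longrightarrow> std_form (contraction p I) (contraction p J) = 0"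
proof -
  obtain v V where v: "P = proj_point (plucker_vector k v)" "isotropic V" "ordered_basis k v V"
    using assms(2) unfolding OGr_def by blast
  then obtain c where p: "p = (\<lambda>M. c * plucker_vector k v M)"
    using assms(3) unfolding proj_point_def by blast
  show "plucker_relations k p"
    unfolding p by (intro plucker_relations_scale plucker_relations_plucker_vector assms(1))
  have "contraction p I \<in> V" if I: "card I = k - 1" for I
  proof -
    obtain d where "contraction (plucker_vector k v) I = (\<Sum>r<k. d r *s v r)"
      using contraction_plucker_vector_expand[OF I, of v] assms(1) by auto
    also have "\<dots> \<in> vec.span (v ` {..<k})"
      by (intro vec.span_sum vec.span_scale vec.span_base) auto
    finally show ?thesis
      using v(3) by (auto simp: p contraction_scale ordered_basis_def intro: vec.span_scale)
  qed
  then show "card I = k - 1 \<Longrightarrow> card J = k - 1 \<Longrightarrow>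
      std_form (contraction p I) (contraction p J) = 0"
    using v(2) by (simp add: isotropic_def)
qed

text \<open>The basis recovered from \<open>p\<close> consists of multiples of contractions, whose
  pairings vanish by \<open>form\<close>; its span is therefore isotropic.\<close>

lemma equations_imp_OGr:
  assumes "1 \<le> k" and "p \<in> ext_power k" and "p \<noteq> (\<lambda>_. 0)" and "plucker_relations k p"
    and form: "\<And>I J. card I = k - 1 \<Longrightarrow> card J = k - 1 \<Longrightarrow>
      std_form (contraction p I) (contraction p J) = 0"
  shows "proj_point p \<in> OGr k"
proof -
  obtain K where K: "p K \<noteq> 0"
    using assms(3) by blast
  then have card: "card K = k"
    using assms(2) by (auto simp: ext_power_def)
  let ?x = "\<lambda>r. sorted_list_of_set K ! r"
  obtain v c where v:
    "\<And>r s. r < k \<Longrightarrow> s < k \<Longrightarrow> vec_nth (v r) (?x s) = (if r = s then 1 else 0)"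
    "\<And>r. v r = c r *s contraction p (K - {?x r})"
    "p = (\<lambda>M. p K * plucker_vector k v M)"
    using plucker_relations_imp_plucker_vector[OF assms(2,4,1) card K] by blast
  \<comment> \<open>Membership in \<open>K\<close> gives \<open>K - {?x r}\<close> the size
    \<open>k - 1\<close> demanded by \<open>form\<close>.\<close>
  have "?x r \<in> K" if "r < k" for r
    using that card by (metis finite sorted_list_of_set.length_sorted_key_list_of_set
        sorted_list_of_set.set_sorted_key_list_of_set nth_mem)
  then have "std_form (v r) (v s) = 0" if "r < k" "s < k" for r s
    using that card form by (simp add: v(2) std_form_left_scale std_form_right_scale)
  then have iso: "isotropic (vec.span (v ` {..<k}))"
    by (intro isotropic_span) auto
  note basis = dual_coordinates_independent[of k v ?x, OF v(1)]
  then have "vec.dim (vec.span (v ` {..<k})) = k"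
    by (simp add: vec.dim_eq_card_independent card_image)
  then have "vec.span (v ` {..<k}) \<in> subspaces_of_dim k"
    by (simp add: subspaces_of_dim_def)
  moreover have "ordered_basis k v (vec.span (v ` {..<k}))"
    using basis by (simp add: ordered_basis_def)
  moreover have "proj_point p = proj_point (plucker_vector k v)"
    by (subst v(3)) (rule proj_point_scale[OF K])
  ultimately show ?thesis
    using iso unfolding OGr_def by blast
qed

theorem theorem2p1:
  fixes k :: nat
  assumes "1 \<le> k" and "k \<le> CARD('n::{finite,linorder})"
  shows "(OGr k :: ('n set \<Rightarrow> complex) set set) \<subseteq> Gr k \<and>
    (Gr k :: ('n set \<Rightarrow> complex) set set) \<subseteq> proj_ext_power k \<and>
    card (unordered_pairs k :: 'n set set set) =
      (CARD('n) choose (k - 1)) * ((CARD('n) choose (k - 1)) + 1) div 2 \<and>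
    (\<forall>P \<in> (proj_ext_power k :: ('n set \<Rightarrow> complex) set set).
       P \<in> OGr k \<longleftrightarrow>
         (\<forall>p\<in>P. plucker_relations k p \<and>
            (\<forall>I J. {I, J} \<in> unordered_pairs k \<longrightarrow>
               (\<Sum>l\<in>UNIV. eps I l * eps J l * coord p I l * coord p J l) = 0)))"
proof (intro conjI ballI)
  fix P :: "('n set \<Rightarrow> complex) set"
  assume "P \<in> proj_ext_power k"
  then obtain q where q: "P = proj_point q" "q \<in> ext_power k" "q \<noteq> (\<lambda>_. 0)"
    unfolding proj_ext_power_def by blast
  have pairs: "{I, J} \<in> unordered_pairs k \<longleftrightarrow> card I = k - 1 \<and> card J = k - 1" for I J :: "'n set"
    by (auto simp: unordered_pairs_def doubleton_eq_iff)
  show "P \<in> OGr k \<longleftrightarrow>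
         (\<forall>p\<in>P. plucker_relations k p \<and>
            (\<forall>I J. {I, J} \<in> unordered_pairs k \<longrightarrow>
               (\<Sum>l\<in>UNIV. eps I l * eps J l * coord p I l * coord p J l) = 0))"
    unfolding pairs contraction_form
  proof
    assume "P \<in> OGr k"
    then show "\<forall>p\<in>P. plucker_relations k p \<and> (\<forall>I J. card I = k - 1 \<and> card J = k - 1 \<longrightarrow>
        std_form (contraction p I) (contraction p J) = 0)"
      using OGr_imp_equations[OF assms(1)] by blast
  next
    assume eqs: "\<forall>p\<in>P. plucker_relations k p \<and> (\<forall>I J. card I = k - 1 \<and> card J = k - 1 \<longrightarrow>
        std_form (contraction p I) (contraction p J) = 0)"
    \<comment> \<open>The scalar \<open>1\<close> exhibits \<open>q\<close> as a representative of
      \<open>P\<close>, to which the equations are then applied.\<close>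
    have "q \<in> P"
      unfolding q(1) proj_point_def by (intro CollectI exI[of _ 1]) simp
    then show "P \<in> OGr k"
      using q(1) eqs equations_imp_OGr[OF assms(1) q(2,3)] by blast
  qed
qed (rule OGr_subset_Gr Gr_subset_proj_ext_power card_unordered_pairs)+

end
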